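(* Let $n\ge 1$, $1\le p\le n$ and $q=n-p$. Let $y_1,\dots,y_p,z_1,\dots,z_q\in\mathbb{R}^n$ be linearly independent and set $$P=\operatorname{conv}\{\pm y_1,\dots,\pm y_p,\pm z_1,\dots,\pm z_q\}\subset\mathbb{R}^n.$$ Let $r$ be an integer with $1\le r\le p$. For each $J\subset[p]$ with $|J|=r$ define $$P_J=\operatorname{conv}\Bigl(\{\pm y_i:i\in[p]\setminus J\}\cup\{\pm\tfrac{r}{p}y_i:i\in J\}\cup\{\pm z_1,\dots,\pm z_q\}\Bigr).$$ Then for every $t>0$, $$\gamma_n(tP)\le\frac{2}{\binom{p}{r}}\sum_{J\subset[p],\ |J|=r}\gamma_n(4t\,P_J).$$
   Context: $\gamma_n$ is the standard Gaussian measure on $\mathbb{R}^n$ and $[p]=\{1,\dots,p\}$. *)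

theory Defs
  imports "HOL-Probability.Probability"
begin

definition std_gaussian :: "'a::euclidean_space measure" where
  "std_gaussian =
     density lborel (\<lambda>x. ennreal ((2 * pi) powr (- (real DIM('a) / 2)) * exp (- (norm x)\<^sup>2 / 2)))"

(* Guarantees that taking real values with the function measure loses nothing below. *)
lemma prob_space_std_gaussian: "prob_space (std_gaussian :: 'a::euclidean_space measure)"
proof
  have norm_sum: "(norm x)\<^sup>2 = (\<Sum>b\<in>Basis. (x \<bullet> b)\<^sup>2)" for x :: 'a
    unfolding power2_norm_eq_inner by (subst euclidean_inner) (simp add: power2_eq_square)
  have powr_eq: "(2 * pi) powr (- (real DIM('a) / 2)) = (\<Prod>b\<in>(Basis::'a set). 1 / sqrt (2 * pi))"
  proof -
    have "(1 / sqrt (2 * pi)) ^ DIM('a) = ((2 * pi) powr (- (1 / 2))) ^ DIM('a)"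
      by (simp add: powr_minus powr_half_sqrt inverse_eq_divide)
    also have "\<dots> = (2 * pi) powr (- (1 / 2) * real DIM('a))"
      by (subst powr_powr[symmetric]) (simp add: powr_realpow del: powr_powr)
    finally show ?thesis by simp
  qed
  have prod_eq: "ennreal ((2 * pi) powr (- (real DIM('a) / 2)) * exp (- (norm x)\<^sup>2 / 2))
      = (\<Prod>b\<in>Basis. ennreal (std_normal_density (x \<bullet> b)))" for x :: 'a
    unfolding powr_eq norm_sum
    by (simp add: std_normal_density_def prod_ennreal prod_dividef flip: exp_sum)
      (simp add: sum_negf sum_divide_distrib power_divide)
  have one: "(\<integral>\<^sup>+ u. ennreal (std_normal_density u) \<partial>lborel) = 1"
    using prob_space.emeasure_space_1[OF prob_space_normal_density[of 1 0]]
    by (simp add: emeasure_density)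
  have "emeasure (std_gaussian :: 'a measure) (space std_gaussian)
      = (\<integral>\<^sup>+ x. (\<Prod>b\<in>Basis. ennreal (std_normal_density ((x::'a) \<bullet> b))) \<partial>lborel)"
    unfolding std_gaussian_def prod_eq by (simp add: emeasure_density)
  also have "\<dots> = (\<Prod>b\<in>(Basis::'a set). \<integral>\<^sup>+ u. ennreal (std_normal_density u) \<partial>lborel)"
    by (rule nn_integral_lborel_prod) auto
  finally show "emeasure (std_gaussian :: 'a measure) (space std_gaussian) = 1"
    by (simp add: one)
qed

(* Independence of a family, not merely of the set of its values: repetitions are excluded. *)
definition lin_indep_family :: "'i set \<Rightarrow> ('i \<Rightarrow> 'a::real_vector) \<Rightarrow> bool" where
  "lin_indep_family I v \<longleftrightarrow> inj_on v I \<and> independent (v ` I)"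

definition cross_poly :: "nat \<Rightarrow> nat \<Rightarrow> (nat \<Rightarrow> 'a::real_vector) \<Rightarrow> (nat \<Rightarrow> 'a) \<Rightarrow> 'a set" where
  "cross_poly p q y z =
     convex hull ((\<Union>i\<in>{1..p}. {y i, - y i}) \<union> (\<Union>j\<in>{1..q}. {z j, - z j}))"

definition shrunk_poly ::
    "nat \<Rightarrow> nat \<Rightarrow> nat \<Rightarrow> nat set \<Rightarrow> (nat \<Rightarrow> 'a::real_vector) \<Rightarrow> (nat \<Rightarrow> 'a) \<Rightarrow> 'a set" where
  "shrunk_poly p q r J y z =
     convex hull ((\<Union>i\<in>{1..p} - J. {y i, - y i})
       \<union> (\<Union>i\<in>J. {(real r / real p) *\<^sub>R y i, - ((real r / real p) *\<^sub>R y i)})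
       \<union> (\<Union>j\<in>{1..q}. {z j, - z j}))"

end

theory Submission
  imports Defs
begin

text \<open>
  The inequality is an average of a pointwise covering statement, and the Gaussian enters only
  as a finite Borel measure.  Assign to a point \<open>x = \<Sum>\<^sub>i a\<^sub>i y\<^sub>i + \<Sum>\<^sub>j b\<^sub>j z\<^sub>j\<close> of \<open>P\<close>, with
  \<open>\<Sum>\<^sub>i \<bar>a\<^sub>i\<bar> + \<Sum>\<^sub>j \<bar>b\<^sub>j\<bar> \<le> 1\<close>, the cost
  \<open>N\<^sub>J = \<Sum>\<^bsub>i \<notin> J\<^esub> \<bar>a\<^sub>i\<bar> + (p/r) \<Sum>\<^bsub>i \<in> J\<^esub> \<bar>a\<^sub>i\<bar> + \<Sum>\<^sub>j \<bar>b\<^sub>j\<bar>\<close>; it is the \<open>\<ell>\<^sub>1\<close>-norm of the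
  coefficients of \<open>x\<close> with respect to the generators of \<open>P\<^sub>J\<close>, so \<open>N\<^sub>J \<le> 4\<close> puts \<open>x\<close> into
  \<open>4 P\<^sub>J\<close>.  An index \<open>i\<close> lies in a uniformly random \<open>r\<close>-subset \<open>J\<close> with probability \<open>r/p\<close>, so its
  expected weight in \<open>N\<^sub>J\<close> is \<open>(1 - r/p) + (r/p)(p/r) \<le> 2\<close>, and the mean of \<open>N\<^sub>J\<close> over \<open>J\<close> is at
  most \<open>2\<close> (\<open>sum_shrunk_cost_le\<close>).  By Markov's inequality \<open>N\<^sub>J \<le> 4\<close> for at least half of all
  \<open>J\<close>.  Thus every point of \<open>tP\<close> is covered by at least half of the sets \<open>4tP\<^sub>J\<close>, and integrating
  the resulting inequality of indicator functions (\<open>measure_le_sum_of_multiple_cover\<close>) gives the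
  claim.
\<close>

section \<open>Symmetric convex hulls in coordinates\<close>

text \<open>
  The combinations of the \<open>v\<^sub>k\<close> with coefficients of \<open>\<ell>\<^sub>1\<close>-norm at most \<open>1\<close> form a convex set,
  the image of the \<open>\<ell>\<^sub>1\<close> ball under a linear map, and this set contains each \<open>\<plusminus>v\<^sub>k\<close>.
\<close>
lemma symmetric_hull_imp_coefficients:
  fixes v :: "'k \<Rightarrow> 'a::real_vector"
  assumes "finite I" and "x \<in> convex hull (\<Union>k\<in>I. {v k, - v k})"
  obtains c where "(\<Sum>k\<in>I. \<bar>c k\<bar>) \<le> 1" and "x = (\<Sum>k\<in>I. c k *\<^sub>R v k)"
proof -
  define S where "S = {\<Sum>k\<in>I. c k *\<^sub>R v k | c. (\<Sum>k\<in>I. \<bar>c k\<bar>) \<le> (1::real)}"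
  have "convex S"
  proof (rule convexI)
    fix x y and a b :: real
    assume "x \<in> S" "y \<in> S" and ab: "0 \<le> a" "0 \<le> b" "a + b = 1"
    then obtain c d where c: "(\<Sum>k\<in>I. \<bar>c k\<bar>) \<le> 1" "x = (\<Sum>k\<in>I. c k *\<^sub>R v k)"
      and d: "(\<Sum>k\<in>I. \<bar>d k\<bar>) \<le> 1" "y = (\<Sum>k\<in>I. d k *\<^sub>R v k)"
      unfolding S_def by blast
    have "(\<Sum>k\<in>I. \<bar>a * c k + b * d k\<bar>) \<le> (\<Sum>k\<in>I. a * \<bar>c k\<bar> + b * \<bar>d k\<bar>)"
      using ab by (intro sum_mono order_trans[OF abs_triangle_ineq]) (simp add: abs_mult)
    also have "\<dots> = a * (\<Sum>k\<in>I. \<bar>c k\<bar>) + b * (\<Sum>k\<in>I. \<bar>d k\<bar>)"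
      by (simp add: sum.distrib sum_distrib_left)
    also have "\<dots> \<le> a * 1 + b * 1"
      using ab c(1) d(1) by (intro add_mono mult_left_mono)
    finally have "(\<Sum>k\<in>I. \<bar>a * c k + b * d k\<bar>) \<le> 1"
      using ab by simp
    moreover have "a *\<^sub>R x + b *\<^sub>R y = (\<Sum>k\<in>I. (a * c k + b * d k) *\<^sub>R v k)"
      by (simp add: c d scaleR_sum_right sum.distrib scaleR_add_left)
    ultimately show "a *\<^sub>R x + b *\<^sub>R y \<in> S"
      unfolding S_def by (intro CollectI exI[of _ "\<lambda>k. a * c k + b * d k"] conjI)
  qed
  moreover have "s *\<^sub>R v k \<in> S" if "k \<in> I" "\<bar>s\<bar> \<le> 1" for k s
  proof -
    have "s *\<^sub>R v k = (\<Sum>l\<in>I. (if l = k then s else 0) *\<^sub>R v l)"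
      using that \<open>finite I\<close> by (simp add: if_distrib[of "\<lambda>c. c *\<^sub>R _"] sum.delta cong: if_cong)
    moreover have "(\<Sum>l\<in>I. \<bar>if l = k then s else 0\<bar>) \<le> 1"
      using that \<open>finite I\<close> by (simp add: if_distrib[of abs] sum.delta cong: if_cong)
    ultimately show ?thesis
      unfolding S_def by (intro CollectI exI[of _ "\<lambda>l. if l = k then s else 0"] conjI)
  qed
  from this[of _ 1] this[of _ "-1"] have "(\<Union>k\<in>I. {v k, - v k}) \<subseteq> S"
    by auto
  ultimately have "convex hull (\<Union>k\<in>I. {v k, - v k}) \<subseteq> S"
    by (simp add: hull_minimal)
  with assms(2) that show ?thesis
    unfolding S_def by blast
qed

text \<open>
  Nonemptiness of the index set guarantees that the hull contains \<open>0\<close>, which absorbs the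
  weight missing from \<open>1\<close>.
\<close>
lemma coefficients_imp_symmetric_hull:
  fixes v :: "'k \<Rightarrow> 'a::real_vector"
  assumes "finite I" and "I \<noteq> {}" and c: "(\<Sum>k\<in>I. \<bar>c k\<bar>) \<le> 1"
  shows "(\<Sum>k\<in>I. c k *\<^sub>R v k) \<in> convex hull (\<Union>k\<in>I. {v k, - v k})" (is "?x \<in> ?K")
proof -
  have pm: "v k \<in> ?K" "- v k \<in> ?K" if "k \<in> I" for k
    using that by (auto intro: hull_inc)
  obtain k0 where "k0 \<in> I"
    using \<open>I \<noteq> {}\<close> by blast
  have zero: "0 \<in> ?K"
    using convexD[OF convex_convex_hull pm[OF \<open>k0 \<in> I\<close>], of "1/2" "1/2"] by simp
  define s where "s = (\<Sum>k\<in>I. \<bar>c k\<bar>)"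
  show ?thesis
  proof (cases "s = 0")
    case True
    then have "?x = 0"
      using \<open>finite I\<close> by (simp add: s_def sum_nonneg_eq_0_iff)
    with zero show ?thesis by simp
  next
    case False
    then have "s > 0"
      unfolding s_def by (metis sum_abs_ge_zero order_le_less)
    define u where "u k = (if c k < 0 then - v k else v k)" for k
    have "(\<Sum>k\<in>I. (\<bar>c k\<bar> / s) *\<^sub>R u k) \<in> ?K"
      using \<open>finite I\<close> \<open>s > 0\<close> pm
      by (intro convex_sum convex_convex_hull) (auto simp: u_def s_def simp flip: sum_divide_distrib)
    then have "s *\<^sub>R (\<Sum>k\<in>I. (\<bar>c k\<bar> / s) *\<^sub>R u k) + (1 - s) *\<^sub>R 0 \<in> ?K"
      using zero \<open>s > 0\<close> c by (intro convexD[OF convex_convex_hull]) (auto simp: s_def)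
    moreover have "s *\<^sub>R (\<Sum>k\<in>I. (\<bar>c k\<bar> / s) *\<^sub>R u k) = ?x"
      using \<open>s > 0\<close> by (auto simp: scaleR_sum_right u_def intro!: sum.cong)
    ultimately show ?thesis by simp
  qed
qed

section \<open>Averaging over subsets of fixed size\<close>

lemma card_subsets_containing:
  assumes "finite A" and "i \<in> A" and "1 \<le> r"
  shows "card {J. J \<subseteq> A \<and> card J = r \<and> i \<in> J} = (card A - 1) choose (r - 1)"
proof -
  let ?B = "{K. K \<subseteq> A - {i} \<and> card K = r - 1}"
  have "{J. J \<subseteq> A \<and> card J = r \<and> i \<in> J} = insert i ` ?B"
  proof (intro equalityI subsetI)
    fix J assume "J \<in> {J. J \<subseteq> A \<and> card J = r \<and> i \<in> J}"
    then have "J - {i} \<in> ?B" "J = insert i (J - {i})"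
      by auto
    then show "J \<in> insert i ` ?B" by blast
  next
    fix J assume "J \<in> insert i ` ?B"
    then obtain K where K: "K \<subseteq> A - {i}" "card K = r - 1" "J = insert i K"
      by blast
    moreover have "finite K" "i \<notin> K"
      using K(1) \<open>finite A\<close> by (auto intro: finite_subset)
    ultimately show "J \<in> {J. J \<subseteq> A \<and> card J = r \<and> i \<in> J}"
      using assms by auto
  qed
  moreover have "inj_on (insert i) ?B"
    by (rule inj_onI) (blast dest: equalityD1 equalityD2)
  ultimately show ?thesis
    using assms by (simp add: card_image n_subsets)
qed

text \<open>
  Double counting: the \<open>M\<close> subsets that contain \<open>i\<close> satisfy \<open>M \<cdot> p = r \<cdot> binom(p, r)\<close>, so their
  total weight \<open>M \<cdot> p / r\<close> is exactly the number of all \<open>r\<close>-subsets, and the other subsets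
  contribute weight \<open>1\<close> each.
\<close>
lemma sum_subset_weight_le:
  assumes "finite A" and "i \<in> A" and "1 \<le> r"
  shows "(\<Sum>J | J \<subseteq> A \<and> card J = r. if i \<in> J then real (card A) / real r else 1)
    \<le> 2 * real (card A choose r)"
proof -
  let ?F = "{J. J \<subseteq> A \<and> card J = r}"
  have "finite ?F"
    using \<open>finite A\<close> by simp
  have "(\<Sum>J\<in>?F. if i \<in> J then real (card A) / real r else 1)
      = (\<Sum>J\<in>?F \<inter> {J. i \<in> J}. real (card A) / real r) + (\<Sum>J\<in>?F \<inter> - {J. i \<in> J}. 1)"
    using \<open>finite ?F\<close> by (simp add: sum.If_cases)
  also have "(\<Sum>J\<in>?F \<inter> {J. i \<in> J}. real (card A) / real r) = real (card A choose r)"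
  proof -
    have "?F \<inter> {J. i \<in> J} = {J. J \<subseteq> A \<and> card J = r \<and> i \<in> J}"
      by blast
    then have "(\<Sum>J\<in>?F \<inter> {J. i \<in> J}. real (card A) / real r)
        = real (card A * (card A - 1 choose (r - 1))) / real r"
      using card_subsets_containing[OF assms] by simp
    also have "\<dots> = real (card A choose r)"
      using \<open>1 \<le> r\<close> by (subst times_binomial_minus1_eq[symmetric]) simp_all
    finally show ?thesis .
  qed
  also have "(\<Sum>J\<in>?F \<inter> - {J. i \<in> J}. 1::real) \<le> (\<Sum>J\<in>?F. 1)"
    using \<open>finite ?F\<close> by (intro sum_mono2) auto
  also have "\<dots> = real (card A choose r)"
    using \<open>finite A\<close> by (simp add: n_subsets)
  finally show ?thesis by simp
qed

lemma sum_shrunk_cost_le: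
  fixes a b :: "'i \<Rightarrow> real"
  assumes "finite A" and "1 \<le> r" and ab: "(\<Sum>i\<in>A. \<bar>a i\<bar>) + (\<Sum>j\<in>B. \<bar>b j\<bar>) \<le> 1"
  shows "(\<Sum>J | J \<subseteq> A \<and> card J = r.
      (\<Sum>i\<in>A. (if i \<in> J then real (card A) / real r else 1) * \<bar>a i\<bar>) + (\<Sum>j\<in>B. \<bar>b j\<bar>))
    \<le> 2 * real (card A choose r)"
proof -
  let ?F = "{J. J \<subseteq> A \<and> card J = r}" and ?N = "real (card A choose r)"
  let ?w = "\<lambda>J i. if i \<in> J then real (card A) / real r else 1"
  have "(\<Sum>J\<in>?F. (\<Sum>i\<in>A. ?w J i * \<bar>a i\<bar>) + (\<Sum>j\<in>B. \<bar>b j\<bar>))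
      = (\<Sum>i\<in>A. (\<Sum>J\<in>?F. ?w J i) * \<bar>a i\<bar>) + ?N * (\<Sum>j\<in>B. \<bar>b j\<bar>)"
    using \<open>finite A\<close>
    by (simp add: sum.distrib n_subsets sum_distrib_right sum.swap[of _ A ?F])
  also have "\<dots> \<le> (\<Sum>i\<in>A. (2 * ?N) * \<bar>a i\<bar>) + (2 * ?N) * (\<Sum>j\<in>B. \<bar>b j\<bar>)"
    using assms by (intro add_mono sum_mono mult_right_mono sum_subset_weight_le sum_nonneg) auto
  also have "\<dots> = (2 * ?N) * ((\<Sum>i\<in>A. \<bar>a i\<bar>) + (\<Sum>j\<in>B. \<bar>b j\<bar>))"
    by (simp add: sum_distrib_left distrib_left)
  also have "\<dots> \<le> (2 * ?N) * 1"
    using ab by (intro mult_left_mono) auto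
  finally show ?thesis by simp
qed

text \<open>Markov's inequality for the counting measure on \<open>F\<close>, at twice the bound on the mean.\<close>
lemma half_le_card_small_values:
  fixes f :: "'b \<Rightarrow> real"
  assumes "finite F" and "\<And>J. J \<in> F \<Longrightarrow> 0 \<le> f J" and "m > 0" and "(\<Sum>J\<in>F. f J) \<le> m * real (card F)"
  shows "real (card F) / 2 \<le> real (card {J\<in>F. f J \<le> 2 * m})"
proof -
  let ?G = "{J\<in>F. f J \<le> 2 * m}"
  have "(\<Sum>J\<in>F - ?G. 2 * m) \<le> (\<Sum>J\<in>F - ?G. f J)"
    by (intro sum_mono) auto
  also have "\<dots> \<le> (\<Sum>J\<in>F. f J)"
    using assms by (intro sum_mono2) auto
  also have "\<dots> \<le> m * real (card F)"
    by fact
  finally have "m * (2 * real (card (F - ?G))) \<le> m * real (card F)"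
    by (simp add: mult_ac)
  then have "2 * real (card (F - ?G)) \<le> real (card F)"
    using \<open>m > 0\<close> by simp
  moreover have "real (card (F - ?G)) = real (card F) - real (card ?G)"
    using \<open>finite F\<close> by (subst card_Diff_subset) (auto intro: of_nat_diff card_mono)
  ultimately show ?thesis by simp
qed

section \<open>Measures of multiple covers\<close>

text \<open>Integrate the pointwise inequality \<open>m \<cdot> 1\<^sub>A \<le> \<Sum>\<^sub>J 1\<^bsub>B J\<^esub>\<close> of indicator functions.\<close>
lemma (in finite_measure) measure_le_sum_of_multiple_cover:
  assumes "finite F" and A: "A \<in> sets M" and B: "\<And>J. J \<in> F \<Longrightarrow> B J \<in> sets M"
    and cover: "\<And>x. x \<in> A \<Longrightarrow> m \<le> real (card {J\<in>F. x \<in> B J})"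
  shows "m * measure M A \<le> (\<Sum>J\<in>F. measure M (B J))"
proof -
  have "m * measure M A = (\<integral>x. m * indicator A x \<partial>M)"
    using A by simp
  also have "\<dots> \<le> (\<integral>x. (\<Sum>J\<in>F. indicator (B J) x) \<partial>M)"
  proof (rule integral_mono)
    fix x
    have "(\<Sum>J\<in>F. indicator (B J) x) = real (card {J\<in>F. x \<in> B J})"
      using \<open>finite F\<close> by (simp add: indicator_def sum.If_cases Int_def)
    then show "m * indicator A x \<le> (\<Sum>J\<in>F. indicator (B J) x)"
      using cover[of x] by (cases "x \<in> A") auto
  qed (use A B in \<open>auto intro!: Bochner_Integration.integrable_sum integrable_mult_right
        simp: less_top[symmetric]\<close>)
  also have "\<dots> = (\<Sum>J\<in>F. measure M (B J))"
    using B by (subst Bochner_Integration.integral_sum) (auto simp: less_top[symmetric])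
  finally show ?thesis .
qed

lemma borel_scaled_hull_of_finite:
  fixes S :: "'a::euclidean_space set"
  assumes "finite S"
  shows "(*\<^sub>R) t ` (convex hull S) \<in> sets std_gaussian"
  using assms by (simp add: std_gaussian_def borel_compact compact_scaling finite_imp_compact_convex_hull)

section \<open>The polytopes and their covering\<close>

text \<open>
  Scaling the coefficients of the shrunk generators by \<open>p / r\<close> undoes the shrinking, and the
  cost bound \<open>4\<close> is absorbed by the dilation.
\<close>
lemma mem_scaled_shrunk_poly:
  fixes y z :: "nat \<Rightarrow> 'a::real_vector"
  assumes "1 \<le> p" and "1 \<le> r" and "J \<subseteq> {1..p}"
    and cost: "(\<Sum>i\<in>{1..p}. (if i \<in> J then real p / real r else 1) * \<bar>a i\<bar>) + (\<Sum>j\<in>{1..q}. \<bar>b j\<bar>) \<le> 4"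
  shows "t *\<^sub>R ((\<Sum>i\<in>{1..p}. a i *\<^sub>R y i) + (\<Sum>j\<in>{1..q}. b j *\<^sub>R z j))
    \<in> (*\<^sub>R) (4 * t) ` shrunk_poly p q r J y z"
proof -
  let ?I = "{1..p} <+> {1..q}"
  define w where "w i = (if i \<in> J then real p / real r else 1)" for i
  define v where "v = case_sum (\<lambda>i. (1 / w i) *\<^sub>R y i) z"
  define c where "c = case_sum (\<lambda>i. w i * a i / 4) (\<lambda>j. b j / 4)"
  have w: "w i > 0" for i
    using assms by (simp add: w_def)
  have "(\<Sum>k\<in>?I. \<bar>c k\<bar>) = ((\<Sum>i\<in>{1..p}. w i * \<bar>a i\<bar>) + (\<Sum>j\<in>{1..q}. \<bar>b j\<bar>)) / 4"
    using w by (simp add: sum.Plus c_def abs_mult abs_of_pos add_divide_distrib sum_divide_distrib)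
  then have "(\<Sum>k\<in>?I. \<bar>c k\<bar>) \<le> 1"
    using cost by (simp add: w_def)
  then have "(\<Sum>k\<in>?I. c k *\<^sub>R v k) \<in> convex hull (\<Union>k\<in>?I. {v k, - v k})"
    using assms by (intro coefficients_imp_symmetric_hull) (auto intro: finite_Plus)
  also have "(\<Union>k\<in>?I. {v k, - v k}) = (\<Union>i\<in>{1..p} - J. {y i, - y i})
       \<union> (\<Union>i\<in>J. {(real r / real p) *\<^sub>R y i, - ((real r / real p) *\<^sub>R y i)})
       \<union> (\<Union>j\<in>{1..q}. {z j, - z j})"
  proof -
    have "(\<Union>i\<in>{1..p}. {v (Inl i), - v (Inl i)})
        = (\<Union>i\<in>{1..p} - J. {v (Inl i), - v (Inl i)}) \<union> (\<Union>i\<in>J. {v (Inl i), - v (Inl i)})"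
      using \<open>J \<subseteq> {1..p}\<close> by blast
    then show ?thesis
      by (simp add: Plus_def image_UN v_def w_def)
  qed
  finally have "(\<Sum>k\<in>?I. c k *\<^sub>R v k) \<in> shrunk_poly p q r J y z"
    unfolding shrunk_poly_def .
  moreover have "t *\<^sub>R ((\<Sum>i\<in>{1..p}. a i *\<^sub>R y i) + (\<Sum>j\<in>{1..q}. b j *\<^sub>R z j))
      = (4 * t) *\<^sub>R (\<Sum>k\<in>?I. c k *\<^sub>R v k)"
    using w by (simp add: sum.Plus c_def v_def scaleR_sum_right scaleR_add_right less_imp_neq[symmetric] mult.commute)
  ultimately show ?thesis by blast
qed

lemma cross_poly_imp_coefficients:
  fixes y z :: "nat \<Rightarrow> 'a::real_vector"
  assumes "x \<in> cross_poly p q y z"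
  obtains a b where "(\<Sum>i\<in>{1..p}. \<bar>a i\<bar>) + (\<Sum>j\<in>{1..q}. \<bar>b j\<bar>) \<le> 1"
    and "x = (\<Sum>i\<in>{1..p}. a i *\<^sub>R y i) + (\<Sum>j\<in>{1..q}. b j *\<^sub>R z j)"
proof -
  let ?I = "{1..p} <+> {1..q}" and ?v = "case_sum y z"
  have "(\<Union>k\<in>?I. {?v k, - ?v k})
      = (\<Union>i\<in>{1..p}. {y i, - y i}) \<union> (\<Union>j\<in>{1..q}. {z j, - z j})"
    by (simp add: Plus_def)
  with assms have "x \<in> convex hull (\<Union>k\<in>?I. {?v k, - ?v k})"
    by (simp add: cross_poly_def)
  moreover have "finite ?I"
    by (intro finite_Plus finite_atLeastAtMost)
  ultimately obtain c where "(\<Sum>k\<in>?I. \<bar>c k\<bar>) \<le> 1" "x = (\<Sum>k\<in>?I. c k *\<^sub>R ?v k)"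
    using symmetric_hull_imp_coefficients by blast
  then show ?thesis
    by (intro that[of "\<lambda>i. c (Inl i)" "\<lambda>j. c (Inr j)"]) (simp_all add: sum.Plus)
qed

theorem lemma3p2:
  fixes y z :: "nat \<Rightarrow> real ^ 'n" and p q r :: nat and t :: real
  assumes "1 \<le> p" and "p \<le> CARD('n)" and "q = CARD('n) - p"
    and "lin_indep_family ({1..p} <+> {1..q}) (case_sum y z)"
    and "1 \<le> r" and "r \<le> p"
    and "t > 0"
  shows "measure std_gaussian ((*\<^sub>R) t ` cross_poly p q y z)
    \<le> 2 / real (p choose r) *
      (\<Sum>J | J \<subseteq> {1..p} \<and> card J = r.
        measure std_gaussian ((*\<^sub>R) (4 * t) ` shrunk_poly p q r J y z))"
proof -
  let ?F = "{J. J \<subseteq> {1..p} \<and> card J = r}"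
  let ?B = "\<lambda>J. (*\<^sub>R) (4 * t) ` shrunk_poly p q r J y z"
  interpret prob_space "std_gaussian :: (real ^ 'n) measure"
    by (rule prob_space_std_gaussian)
  have fin: "finite ?F" and card_F: "card ?F = p choose r"
    by (simp_all add: n_subsets)
  have "real (card ?F) / 2 * measure std_gaussian ((*\<^sub>R) t ` cross_poly p q y z)
      \<le> (\<Sum>J\<in>?F. measure std_gaussian (?B J))"
  proof (rule measure_le_sum_of_multiple_cover[OF fin])
    show "(*\<^sub>R) t ` cross_poly p q y z \<in> sets std_gaussian"
      unfolding cross_poly_def by (intro borel_scaled_hull_of_finite) simp
    show "?B J \<in> sets std_gaussian" if "J \<in> ?F" for J
      using that unfolding shrunk_poly_def
      by (intro borel_scaled_hull_of_finite) (auto intro: finite_subset)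
    fix x assume "x \<in> (*\<^sub>R) t ` cross_poly p q y z"
    then obtain u where u: "u \<in> cross_poly p q y z" "x = t *\<^sub>R u"
      by blast
    from u(1) obtain a b where ab: "(\<Sum>i\<in>{1..p}. \<bar>a i\<bar>) + (\<Sum>j\<in>{1..q}. \<bar>b j\<bar>) \<le> 1"
      and u_eq: "u = (\<Sum>i\<in>{1..p}. a i *\<^sub>R y i) + (\<Sum>j\<in>{1..q}. b j *\<^sub>R z j)"
      by (rule cross_poly_imp_coefficients)
    let ?N = "\<lambda>J. (\<Sum>i\<in>{1..p}. (if i \<in> J then real p / real r else 1) * \<bar>a i\<bar>) + (\<Sum>j\<in>{1..q}. \<bar>b j\<bar>)"
    have "(\<Sum>J\<in>?F. ?N J) \<le> 2 * real (card ?F)"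
      using sum_shrunk_cost_le[OF finite_atLeastAtMost \<open>1 \<le> r\<close> ab] unfolding card_F
      by (simp cong: if_cong)
    then have "real (card ?F) / 2 \<le> real (card {J\<in>?F. ?N J \<le> 2 * 2})"
      by (intro half_le_card_small_values fin add_nonneg_nonneg sum_nonneg) auto
    also have "{J\<in>?F. ?N J \<le> 2 * 2} \<subseteq> {J\<in>?F. x \<in> ?B J}"
      using mem_scaled_shrunk_poly[OF \<open>1 \<le> p\<close> \<open>1 \<le> r\<close>] by (auto simp: u(2) u_eq)
    then have "real (card {J\<in>?F. ?N J \<le> 2 * 2}) \<le> real (card {J\<in>?F. x \<in> ?B J})"
      using fin by (intro of_nat_mono card_mono) auto
    finally show "real (card ?F) / 2 \<le> real (card {J\<in>?F. x \<in> ?B J})" .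
  qed
  moreover have "real (p choose r) > 0"
    using \<open>r \<le> p\<close> by simp
  ultimately show ?thesis
    unfolding card_F by (simp add: field_simps)
qed

end
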